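(* Let $n\geqslant 1$ and $r\geqslant 1$ be integers and let $S$ be a set of real $n\times n$ matrices, each of rank $r$, such that there exists $N$ with the property that every product $M_1M_2\cdots M_\ell$ with $\ell\geqslant N$ and $M_i\in S$ has rank at most $r-1$. Then every product $M_1M_2\cdots M_{2^{n+1}}$ of $2^{n+1}$ elements $M_i\in S$ has rank at most $r-1$. *)

theory Defs
  imports "HOL-Analysis.Analysis"
begin

text \<open>Product M_1 M_2 ... M_l of a list of square matrices (empty product = identity).\<close>
definition mat_list_prod :: "(real^'n^'n) list \<Rightarrow> real^'n^'n" where
  "mat_list_prod ms = foldr (\<lambda>A B. A ** B) ms (mat 1)"

end

theory Submission
  imports Defs
begin

text \<open>
  Suppose a product M_0 ... M_(L-1) of rank-r matrices from S still has rank r. Then every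
  adjacent product M_t M_(t+1) has rank r, i.e. range M_(t+1) meets ker M_t trivially, whereas
  no product M_j M_i with i \<le> j has rank r: otherwise the cycle M_i, ..., M_j could be
  traversed again and again without losing rank, giving arbitrarily long products of rank r.

  Pair an r-dimensional range with an (n-r)-dimensional kernel by the determinant of their
  stacked spanning vectors. It is nonzero iff the two subspaces meet trivially, and it is a
  linear function of the Pluecker vector of the range, a vector in R^(2^n). So the pairings of
  ker M_j with range M_(i+1) form a triangular matrix with nonzero diagonal, the Pluecker vectors
  of range M_1, ..., range M_(L-1) are linearly independent, and L - 1 \<le> 2^n < 2^(n+1) - 1.
\<close>

lemma mat_list_prod_Nil [simp]: "mat_list_prod [] = mat 1"
  by (simp add: mat_list_prod_def)

lemma mat_list_prod_Cons [simp]: "mat_list_prod (A # ms) = A ** mat_list_prod ms"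
  by (simp add: mat_list_prod_def)

lemma rank_mat_list_prod_le_adjacent:
  fixes ms :: "(real^'n^'n) list"
  assumes "Suc t < length ms"
  shows "rank (mat_list_prod ms) \<le> rank (ms ! t ** ms ! Suc t)"
  using assms
proof (induction ms arbitrary: t)
  case (Cons A ms)
  show ?case
  proof (cases t)
    case 0
    then obtain B ms' where "ms = B # ms'"
      using Cons.prems by (cases ms) auto
    then have "mat_list_prod (A # ms) = (A ** B) ** mat_list_prod ms'"
      by (simp add: matrix_mul_assoc)
    then show ?thesis
      using 0 \<open>ms = B # ms'\<close> rank_mul_le_left[of "A ** B" "mat_list_prod ms'"] by simp
  next
    case (Suc t')
    then have "rank (mat_list_prod ms) \<le> rank (ms ! t' ** ms ! Suc t')"
      using Cons by simp
    then show ?thesis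
      using Suc rank_mul_le_right[of A "mat_list_prod ms"] by simp
  qed
qed simp

lemma range_matrix_mul:
  "range ((*v) (A ** B)) = (*v) A ` range ((*v) B)"
  by (auto simp: matrix_vector_mul_assoc[symmetric] image_iff)

lemma subspace_range_matrix_vector_mult: "subspace (range ((*v) (A :: real^'n^'m)))"
  by (simp add: linear_subspace_image matrix_vector_mul_linear)

lemma range_matrix_mul_eq_if_rank_le:
  fixes A :: "real^'n^'m" and B :: "real^'p^'n"
  assumes "rank A \<le> rank (A ** B)"
  shows "range ((*v) (A ** B)) = range ((*v) A)"
proof (rule subspace_dim_equal[OF subspace_range_matrix_vector_mult subspace_range_matrix_vector_mult])
  show "range ((*v) (A ** B)) \<subseteq> range ((*v) A)"
    by (auto simp: range_matrix_mul)
  show "dim (range ((*v) A)) \<le> dim (range ((*v) (A ** B)))"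
    using assms by (simp add: rank_dim_range)
qed

lemma range_mat_list_prod_chain:
  fixes ms :: "(real^'n^'n) list"
  assumes "ms \<noteq> []" "\<forall>A\<in>set ms. rank A = r"
    and "\<And>t. Suc t < length ms \<Longrightarrow> r \<le> rank (ms ! t ** ms ! Suc t)"
  shows "range ((*v) (mat_list_prod ms)) = range ((*v) (hd ms))"
  using assms
proof (induction ms rule: induct_list012)
  case (3 A B ms)
  have "range ((*v) (mat_list_prod (B # ms))) = range ((*v) (hd (B # ms)))"
  proof (rule "3.IH"(2))
    fix t
    assume "Suc t < length (B # ms)"
    then show "r \<le> rank ((B # ms) ! t ** (B # ms) ! Suc t)"
      using "3.prems"(3)[of "Suc t"] by simp
  qed (use "3.prems" in auto)
  then have "range ((*v) (mat_list_prod (A # B # ms))) = range ((*v) (A ** B))"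
    by (simp add: range_matrix_mul)
  also have "\<dots> = range ((*v) A)"
    using "3.prems"(2) "3.prems"(3)[of 0] by (intro range_matrix_mul_eq_if_rank_le) simp
  finally show ?case by simp
qed simp_all

lemma rank_mat_list_prod_chain:
  fixes ms :: "(real^'n^'n) list"
  assumes "ms \<noteq> []" "\<forall>A\<in>set ms. rank A = r"
    and "\<And>t. Suc t < length ms \<Longrightarrow> r \<le> rank (ms ! t ** ms ! Suc t)"
  shows "rank (mat_list_prod ms) = r"
  using range_mat_list_prod_chain[OF assms] assms(1,2) by (simp add: rank_dim_range)

lemma dim_image_eq_iff_inj_on:
  fixes f :: "'a::euclidean_space \<Rightarrow> 'b::euclidean_space"
  assumes f: "linear f" and V: "subspace V"
  shows "dim (f ` V) = dim V \<longleftrightarrow> inj_on f V"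
proof
  assume dim_eq: "dim (f ` V) = dim V"
  obtain B where B: "B \<subseteq> V" "independent B" "V \<subseteq> span B" "card B = dim V"
    using basis_exists by blast
  have fin: "finite B"
    using B(2) finiteI_independent by blast
  have span_B: "span B = V"
    using B V span_subspace by blast
  have "f ` V \<subseteq> span (f ` B)"
    using span_B f by (auto simp: linear_span_image)
  then have "dim (f ` V) \<le> card (f ` B)"
    using fin by (simp add: dim_le_card)
  moreover have "card (f ` B) \<le> card B"
    using fin by (rule card_image_le)
  ultimately have card_eq: "card (f ` B) = card B" and "card (f ` B) = dim (f ` V)"
    using dim_eq B(4) by linarith+
  then have "independent (f ` B)"
    using card_eq_dim[of "f ` B" "f ` V"] \<open>f ` V \<subseteq> span (f ` B)\<close> B(1) fin by blast
  moreover have "inj_on f B"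
    using card_eq fin by (simp add: eq_card_imp_inj_on)
  ultimately have "inj_on f (span B)"
    using f by (simp add: linear_inj_on_span_iff_independent_image)
  then show "inj_on f V"
    using span_B by simp
next
  assume "inj_on f V"
  moreover have "span V = V"
    using V by (simp add: span_eq_iff)
  ultimately show "dim (f ` V) = dim V"
    by (metis dim_image_eq[OF f])
qed

lemma rank_le_rank_mult_iff:
  fixes A :: "real^'n^'m" and B :: "real^'m^'k"
  shows "rank A \<le> rank (B ** A) \<longleftrightarrow> range ((*v) A) \<inter> {x. B *v x = 0} = {0}"
proof -
  have "rank (B ** A) = dim ((*v) B ` range ((*v) A))"
    by (simp add: rank_dim_range range_matrix_mul)
  moreover have "dim ((*v) B ` range ((*v) A)) \<le> dim (range ((*v) A))"
    using dim_image_le matrix_vector_mul_linear by blast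
  moreover have "dim ((*v) B ` range ((*v) A)) = dim (range ((*v) A))
      \<longleftrightarrow> inj_on ((*v) B) (range ((*v) A))"
    by (rule dim_image_eq_iff_inj_on[OF matrix_vector_mul_linear subspace_range_matrix_vector_mult])
  ultimately have "rank A \<le> rank (B ** A) \<longleftrightarrow> inj_on ((*v) B) (range ((*v) A))"
    by (auto simp: rank_dim_range)
  also have "\<dots> \<longleftrightarrow> (\<forall>x\<in>range ((*v) A). B *v x = 0 \<longrightarrow> x = 0)"
    by (rule linear_inj_on_iff_eq_0[OF matrix_vector_mul_linear subspace_range_matrix_vector_mult])
  also have "\<dots> \<longleftrightarrow> range ((*v) A) \<inter> {x. B *v x = 0} = {0}"
    using range_eqI[of 0 "(*v) A" 0] by auto
  finally show ?thesis .
qed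

lemma dim_kernel_matrix:
  fixes B :: "real^'n^'m"
  shows "dim {x. B *v x = 0} = CARD('n) - rank B"
proof -
  have "{y. \<forall>x \<in> span (rows B). orthogonal x y} = {x. B *v x = 0}"
  proof (intro set_eqI iffI; simp)
    fix y
    assume "\<forall>x\<in>span (rows B). orthogonal x y"
    moreover have "row i B \<in> span (rows B)" for i
      by (auto simp: rows_def intro: span_base)
    ultimately have "B $ i \<bullet> y = 0" for i
      by (simp add: orthogonal_def row_def)
    then show "B *v y = 0"
      by (simp add: vec_eq_iff matrix_vector_mul_component)
  next
    fix y
    assume "B *v y = 0"
    then show "\<forall>x\<in>span (rows B). orthogonal x y"
      using orthogonal_nullspace_rowspace orthogonal_commute by blast
  qed
  moreover have "dim {y \<in> UNIV. \<forall>x \<in> span (rows B). orthogonal x y} + dim (span (rows B)) = CARD('n)"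
    using dim_subspace_orthogonal_to_vectors[of "span (rows B)" UNIV] by simp
  ultimately show ?thesis
    by (simp add: row_rank_def)
qed

lemma obtain_spanning_family:
  fixes V :: "'a::euclidean_space set"
  assumes "subspace V" "finite I" "card I = dim V"
  obtains u :: "'i \<Rightarrow> 'a" where "span (u ` I) = V"
proof -
  obtain B where B: "B \<subseteq> V" "independent B" "V \<subseteq> span B" "card B = dim V"
    using basis_exists by blast
  then obtain u where "bij_betw u I B"
    using assms finiteI_independent[OF B(2)] finite_same_card_bij[of I B] by auto
  then have "u ` I = B"
    by (simp add: bij_betw_def)
  then show ?thesis
    using that B assms(1) span_subspace by blast
qed

definition join_rows :: "'n::finite set \<Rightarrow> ('n \<Rightarrow> 'a) \<Rightarrow> ('n \<Rightarrow> 'a) \<Rightarrow> 'a^'n" where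
  "join_rows R u w = (\<chi> i. if i \<in> R then u i else w i)"

lemma rows_join_rows:
  fixes u w :: "'n::finite \<Rightarrow> real^'m"
  shows "rows (join_rows R u w) = u ` R \<union> w ` (-R)"
  by (auto simp: rows_def row_def join_rows_def vec_lambda_eta)

lemma det_join_rows_ne_0_iff:
  fixes u w :: "'n::finite \<Rightarrow> real^'n"
  assumes "dim (u ` R) = card R" "dim (w ` (-R)) = card (-R)"
  shows "det (join_rows R u w) \<noteq> 0 \<longleftrightarrow> span (u ` R) \<inter> span (w ` (-R)) = {0}"
proof -
  let ?U = "span (u ` R)" and ?W = "span (w ` (-R))"
  have "span (rows (join_rows R u w)) = {x + y |x y. x \<in> ?U \<and> y \<in> ?W}"
    by (auto simp: rows_join_rows span_Un)
  then have "rank (join_rows R u w) = dim {x + y |x y. x \<in> ?U \<and> y \<in> ?W}"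
    by (metis dim_span row_rank_def)
  moreover have "dim {x + y |x y. x \<in> ?U \<and> y \<in> ?W} + dim (?U \<inter> ?W) = CARD('n)"
    using dim_sums_Int[OF subspace_span subspace_span, of "u ` R" "w ` (-R)"] assms
      card_Un_disjoint[of R "-R"] by simp
  ultimately have "det (join_rows R u w) \<noteq> 0 \<longleftrightarrow> dim (?U \<inter> ?W) = 0"
    using rank_bound[of "join_rows R u w"] by (auto simp: det_eq_0_rank simp del: dim_eq_0)
  then show ?thesis
    by (auto simp: span_zero)
qed

definition compl_bij :: "'n set \<Rightarrow> 'n set \<Rightarrow> 'n \<Rightarrow> 'n" where
  "compl_bij R S = (SOME g. bij_betw g (-R) S)"

text \<open>Coordinate S completes the rows u i, i \<in> R, by the unit vectors e_j, j \<in> S, so up to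
  sign it is the minor of these rows on the columns outside S; it is junk unless
  card S = card (-R).\<close>

definition plucker :: "'n::finite set \<Rightarrow> ('n \<Rightarrow> real^'n) \<Rightarrow> real^('n set)" where
  "plucker R u = (\<chi> S. det (join_rows R u (\<lambda>i. axis (compl_bij R S i) 1)))"

lemma det_join_rows_reindex:
  fixes v :: "'n::finite \<Rightarrow> 'a::comm_ring_1^'n"
  assumes f: "bij_betw f (-R) S" and g: "bij_betw g (-R) S"
  obtains s :: 'a
  where "\<And>u. det (join_rows R u (\<lambda>i. v (f i))) = s * det (join_rows R u (\<lambda>i. v (g i)))"
proof -
  define p where "p i = (if i \<in> R then i else inv_into (-R) g (f i))" for i
  have "bij_betw (inv_into (-R) g \<circ> f) (-R) (-R)"
    using bij_betw_trans[OF f bij_betw_inv_into[OF g]] .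
  then have "bij_betw p (-R) (-R)"
    by (rule bij_betw_cong[THEN iffD1, rotated]) (simp add: p_def)
  then have "p permutes (-R)"
    by (rule bij_imp_permutes) (simp add: p_def)
  then have "p permutes UNIV"
    by (rule permutes_subset) simp
  moreover have "(\<chi> i. join_rows R u (\<lambda>i. v (g i)) $ p i) = join_rows R u (\<lambda>i. v (f i))" for u
  proof -
    have "p i \<notin> R \<and> g (p i) = f i" if "i \<notin> R" for i
    proof -
      have "f i \<in> g ` (-R)"
        using f g that by (auto simp: bij_betw_def)
      then have "inv_into (-R) g (f i) \<in> -R" and "g (inv_into (-R) g (f i)) = f i"
        by (rule inv_into_into, rule f_inv_into_f)
      then show ?thesis
        using that by (simp add: p_def)
    qed
    then show ?thesis
      by (auto simp: join_rows_def p_def vec_eq_iff)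
  qed
  ultimately show ?thesis
    using that[of "of_int (sign p)"] det_permute_rows by metis
qed

lemma det_join_rows_axis_eq_inner_plucker:
  fixes f :: "'n::finite \<Rightarrow> 'n"
  obtains z where "\<And>u. det (join_rows R u (\<lambda>i. axis (f i) 1)) = z \<bullet> plucker R u"
proof (cases "inj_on f (-R)")
  case True
  let ?S = "f ` (-R)"
  have f: "bij_betw f (-R) ?S"
    using True by (simp add: bij_betw_def)
  then have "bij_betw (compl_bij R ?S) (-R) ?S"
    unfolding compl_bij_def by (rule someI[of "\<lambda>g. bij_betw g (-R) ?S"])
  then obtain s :: real where s: "\<And>u. det (join_rows R u (\<lambda>i. axis (f i) 1))
      = s * det (join_rows R u (\<lambda>i. axis (compl_bij R ?S i) 1))"
    using det_join_rows_reindex[OF f, of _ "\<lambda>j. axis j 1"] by blast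
  show ?thesis
    by (rule that[of "s *\<^sub>R axis ?S 1"]) (simp add: s plucker_def inner_axis')
next
  case False
  then obtain i j where "i \<in> -R" "j \<in> -R" "i \<noteq> j" "f i = f j"
    by (auto simp: inj_on_def)
  then have "det (join_rows R u (\<lambda>i. axis (f i) 1)) = 0" for u
    by (intro det_identical_rows[of i j]) (auto simp: row_def join_rows_def vec_lambda_eta)
  then show ?thesis
    by (intro that[of 0]) simp
qed

lemma det_join_rows_expand:
  fixes u w :: "'n::finite \<Rightarrow> real^'n"
  shows "det (join_rows R u w) = (\<Sum>f\<in>{f. \<forall>i\<in>R. f i = i}.
    (\<Prod>i\<in>-R. w i $ f i) * det (join_rows R u (\<lambda>i. axis (f i) 1)))"
proof -
  have F: "{f. (\<forall>i\<in>-R. f i \<in> UNIV) \<and> (\<forall>i. i \<notin> -R \<longrightarrow> f i = i)} = {f. \<forall>i\<in>R. f i = i}"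
    by auto
  have "join_rows R u w = (\<chi> i. if i \<in> -R then \<Sum>j\<in>UNIV. (w i $ j) *s axis j 1 else u i)"
    by (simp add: join_rows_def basis_expansion vec_eq_iff)
  then have "det (join_rows R u w)
      = (\<Sum>f\<in>{f. \<forall>i\<in>R. f i = i}. det (\<chi> i. if i \<in> -R then (w i $ f i) *s axis (f i) 1 else u i))"
    by (simp only: det_linear_rows_sum_lemma[OF finite finite] F)
  also have "\<dots> = (\<Sum>f\<in>{f. \<forall>i\<in>R. f i = i}.
      (\<Prod>i\<in>-R. w i $ f i) * det (join_rows R u (\<lambda>i. axis (f i) 1)))"
  proof (rule sum.cong)
    fix f :: "'n \<Rightarrow> 'n"
    let ?c = "\<lambda>i. if i \<in> R then 1 else w i $ f i"
    have "(\<chi> i. if i \<in> -R then (w i $ f i) *s axis (f i) 1 else u i)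
        = (\<chi> i. ?c i *s join_rows R u (\<lambda>i. axis (f i) 1) $ i)"
      by (simp add: join_rows_def vec_eq_iff)
    moreover have "prod ?c UNIV = (\<Prod>i\<in>-R. w i $ f i)"
      by (simp add: prod.If_cases Compl_eq_Diff_UNIV)
    ultimately show "det (\<chi> i. if i \<in> -R then (w i $ f i) *s axis (f i) 1 else u i)
        = (\<Prod>i\<in>-R. w i $ f i) * det (join_rows R u (\<lambda>i. axis (f i) 1))"
      by (simp add: det_rows_mul vec_lambda_eta)
  qed simp
  finally show ?thesis .
qed

lemma det_join_rows_eq_inner_plucker:
  fixes w :: "'n::finite \<Rightarrow> real^'n"
  obtains z where "\<And>u. det (join_rows R u w) = z \<bullet> plucker R u"
proof -
  obtain \<zeta> where \<zeta>: "\<And>f u. det (join_rows R u (\<lambda>i. axis (f i) 1)) = \<zeta> f \<bullet> plucker R u"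
    using det_join_rows_axis_eq_inner_plucker by metis
  show ?thesis
    by (rule that[of "\<Sum>f\<in>{f. \<forall>i\<in>R. f i = i}. (\<Prod>i\<in>-R. w i $ f i) *\<^sub>R \<zeta> f"])
      (subst det_join_rows_expand, simp add: \<zeta> inner_sum_left)
qed

lemma triangular_family_length_le_DIM:
  fixes v z :: "nat \<Rightarrow> 'a::euclidean_space"
  assumes diag: "\<And>j. j < m \<Longrightarrow> z j \<bullet> v j \<noteq> 0"
    and below: "\<And>i j. i < j \<Longrightarrow> j < m \<Longrightarrow> z j \<bullet> v i = 0"
  shows "m \<le> DIM('a)"
proof -
  have "dim (v ` {..<k}) = k" if "k \<le> m" for k
    using that
  proof (induction k)
    case (Suc k)
    have "v ` {..<k} \<subseteq> {x. z k \<bullet> x = 0}"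
      using below Suc.prems by auto
    then have "span (v ` {..<k}) \<subseteq> {x. z k \<bullet> x = 0}"
      using span_minimal subspace_hyperplane by blast
    then have "v k \<notin> span (v ` {..<k})"
      using diag Suc.prems by auto
    then show ?case
      using Suc by (simp add: lessThan_Suc dim_insert)
  qed simp
  then show ?thesis
    using dim_subset_UNIV[of "v ` {..<m}"] by simp
qed

lemma plucker_rank_criterion:
  assumes "r \<le> CARD('n::finite)"
  obtains z v :: "real^'n^'n \<Rightarrow> real^('n set)"
  where "\<And>A B. rank A = r \<Longrightarrow> rank B = r \<Longrightarrow> z B \<bullet> v A \<noteq> 0 \<longleftrightarrow> rank A \<le> rank (B ** A)"
proof -
  obtain R :: "'n set" where R: "card R = r"
    using obtain_subset_with_card_n[of r UNIV] assms by auto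
  have card_compl: "card (-R) = CARD('n) - r"
    using R card_Un_disjoint[of R "-R"] by simp
  define u where "u A = (SOME u. span (u ` R) = range ((*v) A))" for A :: "real^'n^'n"
  define w where "w B = (SOME w. span (w ` (-R)) = {x. B *v x = 0})" for B :: "real^'n^'n"
  have u: "span (u A ` R) = range ((*v) A)" if "rank A = r" for A
  proof -
    have "card R = dim (range ((*v) A))"
      using R that by (simp add: rank_dim_range)
    then obtain u' :: "'n \<Rightarrow> real^'n" where "span (u' ` R) = range ((*v) A)"
      by (rule obtain_spanning_family[OF subspace_range_matrix_vector_mult finite])
    then show ?thesis
      unfolding u_def by (rule someI[where P = "\<lambda>u. span (u ` R) = range ((*v) A)"])
  qed
  have w: "span (w B ` (-R)) = {x. B *v x = 0}" if "rank B = r" for B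
  proof -
    have "card (-R) = dim {x. B *v x = 0}"
      using card_compl that by (simp add: dim_kernel_matrix)
    then obtain w' :: "'n \<Rightarrow> real^'n" where "span (w' ` (-R)) = {x. B *v x = 0}"
      by (rule obtain_spanning_family[OF linear_subspace_kernel[OF matrix_vector_mul_linear] finite])
    then show ?thesis
      unfolding w_def by (rule someI[where P = "\<lambda>w. span (w ` (-R)) = {x. B *v x = 0}"])
  qed
  have "\<exists>z. \<forall>u. det (join_rows R u (w B)) = z \<bullet> plucker R u" for B
    by (rule det_join_rows_eq_inner_plucker[of R "w B"]) blast
  then obtain z where z: "\<And>B u. det (join_rows R u (w B)) = z B \<bullet> plucker R u"
    by metis
  show ?thesis
  proof (rule that[of z "\<lambda>A. plucker R (u A)"])
    fix A B :: "real^'n^'n"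
    assume A: "rank A = r" and B: "rank B = r"
    have "dim (u A ` R) = card R"
      using u[OF A] A R by (metis dim_span rank_dim_range)
    moreover have "dim (w B ` (-R)) = card (-R)"
      using w[OF B] B card_compl by (metis dim_span dim_kernel_matrix)
    ultimately have "det (join_rows R (u A) (w B)) \<noteq> 0
        \<longleftrightarrow> range ((*v) A) \<inter> {x. B *v x = 0} = {0}"
      using det_join_rows_ne_0_iff u[OF A] w[OF B] by metis
    then show "z B \<bullet> plucker R (u A) \<noteq> 0 \<longleftrightarrow> rank A \<le> rank (B ** A)"
      by (simp add: z rank_le_rank_mult_iff)
  qed
qed

lemma length_le_without_back_edges:
  fixes ms :: "(real^'n^'n) list"
  assumes rank: "\<forall>A\<in>set ms. rank A = r"
    and forward: "\<And>t. Suc t < length ms \<Longrightarrow> r \<le> rank (ms ! t ** ms ! Suc t)"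
    and no_back: "\<And>i j. i \<le> j \<Longrightarrow> j < length ms \<Longrightarrow> rank (ms ! j ** ms ! i) < r"
  shows "length ms \<le> 2 ^ CARD('n) + 1"
proof (cases "ms = []")
  case False
  then have "r \<le> CARD('n)"
    using rank rank_bound[of "hd ms"] by simp
  then obtain z v :: "real^'n^'n \<Rightarrow> real^('n set)" where vz:
    "\<And>A B. rank A = r \<Longrightarrow> rank B = r \<Longrightarrow> z B \<bullet> v A \<noteq> 0 \<longleftrightarrow> rank A \<le> rank (B ** A)"
    by (rule plucker_rank_criterion) blast
  have rank_nth: "rank (ms ! t) = r" if "t < length ms" for t
    using rank that by simp
  have "length ms - 1 \<le> DIM(real^('n set))"
  proof (rule triangular_family_length_le_DIM[of _ "\<lambda>t. z (ms ! t)" "\<lambda>t. v (ms ! Suc t)"])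
    fix j
    assume "j < length ms - 1"
    then show "z (ms ! j) \<bullet> v (ms ! Suc j) \<noteq> 0"
      using vz rank_nth forward by simp
  next
    fix i j
    assume "i < j" "j < length ms - 1"
    then have "Suc i \<le> j" "j < length ms"
      by simp_all
    then have "\<not> rank (ms ! Suc i) \<le> rank (ms ! j ** ms ! Suc i)"
      using no_back[of "Suc i" j] rank_nth[of "Suc i"] by simp
    then show "z (ms ! j) \<bullet> v (ms ! Suc i) = 0"
      using vz[of "ms ! Suc i" "ms ! j"] rank_nth \<open>Suc i \<le> j\<close> \<open>j < length ms\<close> by simp
  qed
  then show ?thesis
    by simp
qed simp

lemma long_rank_product_of_back_edge:
  fixes ms :: "(real^'n^'n) list"
  assumes rank: "\<forall>A\<in>set ms. rank A = r"
    and forward: "\<And>t. Suc t < length ms \<Longrightarrow> r \<le> rank (ms ! t ** ms ! Suc t)"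
    and cycle: "i \<le> j" "j < length ms" "r \<le> rank (ms ! j ** ms ! i)"
    and "0 < K"
  shows "\<exists>ms'. length ms' = K \<and> set ms' \<subseteq> set ms \<and> rank (mat_list_prod ms') = r"
proof -
  define p where "p = Suc j - i"
  define a where "a t = ms ! (i + t mod p)" for t
  have p: "0 < p" "i + p = Suc j"
    using cycle by (simp_all add: p_def)
  have index: "i + t mod p < length ms" for t
    using p cycle(2) mod_less_divisor[of p t] by linarith
  have "r \<le> rank (a t ** a (Suc t))" for t
  proof (cases "Suc (t mod p) = p")
    case True
    then have "Suc t mod p = 0" "i + t mod p = j"
      using p by (simp_all add: mod_Suc)
    then show ?thesis
      using cycle by (simp add: a_def)
  next
    case False
    then have "Suc t mod p = Suc (t mod p)"
      by (simp add: mod_Suc)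
    moreover have "Suc (i + t mod p) < length ms"
      using False p cycle mod_less_divisor[of p t] by linarith
    ultimately show ?thesis
      using forward by (simp add: a_def)
  qed
  moreover have "rank (a t) = r" for t
    using rank index by (simp add: a_def)
  ultimately have "rank (mat_list_prod (map a [0..<K])) = r"
    using \<open>0 < K\<close> by (intro rank_mat_list_prod_chain) auto
  moreover have "set (map a [0..<K]) \<subseteq> set ms"
    using index by (auto simp: a_def)
  ultimately show ?thesis
    by (intro exI[of _ "map a [0..<K]"]) simp
qed

theorem mainTheorem2:
  fixes S :: "(real^'n^'n) set" and r :: nat
  assumes "r \<ge> 1"
    and "\<forall>M\<in>S. rank M = r"
    and "\<exists>N::nat. \<forall>ms. length ms \<ge> N \<and> set ms \<subseteq> S \<longrightarrow> rank (mat_list_prod ms) \<le> r - 1"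
  shows "\<forall>ms. length ms = 2 ^ (CARD('n) + 1) \<and> set ms \<subseteq> S \<longrightarrow> rank (mat_list_prod ms) \<le> r - 1"
proof (intro allI impI)
  fix ms :: "(real^'n^'n) list"
  assume ms: "length ms = 2 ^ (CARD('n) + 1) \<and> set ms \<subseteq> S"
  obtain N where N: "\<forall>ms. length ms \<ge> N \<and> set ms \<subseteq> S \<longrightarrow> rank (mat_list_prod ms) \<le> r - 1"
    using assms(3) by blast
  have rank: "\<forall>A\<in>set ms. rank A = r"
    using ms assms(2) by blast
  show "rank (mat_list_prod ms) \<le> r - 1"
  proof (rule ccontr)
    assume "\<not> ?thesis"
    then have forward: "r \<le> rank (ms ! t ** ms ! Suc t)" if "Suc t < length ms" for t
      using rank_mat_list_prod_le_adjacent[OF that] by linarith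
    have no_back: "rank (ms ! j ** ms ! i) < r" if ij: "i \<le> j" "j < length ms" for i j
    proof (rule ccontr)
      assume "\<not> ?thesis"
      then obtain ms' where "length ms' = N + 1" "set ms' \<subseteq> S" "rank (mat_list_prod ms') = r"
        using long_rank_product_of_back_edge[OF rank forward ij, of "N + 1"] ms by fastforce
      then have "r \<le> r - 1"
        using N by auto
      then show False
        using assms(1) by simp
    qed
    have "length ms \<le> 2 ^ CARD('n) + 1"
      by (rule length_le_without_back_edges[OF rank forward no_back])
    moreover have "(2::nat) \<le> 2 ^ CARD('n)"
      using power_increasing[of 1 "CARD('n)" "2::nat"] by simp
    ultimately show False
      using ms by simp
  qed
qed

end
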